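(* For every simple graph $Y$ on $n$ vertices, the diameter of any connected component of $\mathsf{FS}(\mathsf{Cycle}_n,Y)$ is at most $8n^4(1+o(1))$, where the $o(1)$ term depends only on $n$ and tends to $0$ as $n\to\infty$.
   Context: For simple graphs $X,Y$ on $n$ vertices, $\mathsf{FS}(X,Y)$ has as vertices all bijections $V(X)\to V(Y)$, with $\sigma,\tau$ adjacent iff there is an edge $\{a,b\}\in E(X)$ such that $\{\sigma(a),\sigma(b)\}\in E(Y)$, $\tau(a)=\sigma(b)$, $\tau(b)=\sigma(a)$, and $\tau(c)=\sigma(c)$ for all other $c$. $\mathsf{Cycle}_n$ is the cycle on $[n]$ with edges $\{i,i+1\}$ for $i\in[n-1]$ and $\{n,1\}$. *)

theory Defs
  imports "Graph_Theory.Graph_Theory" "HOL-Library.FuncSet"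
begin

text \<open>
  Finite simple graphs are the symmetric loop-free pair digraphs \<^locale>\<open>pair_graph\<close>:
  an undirected edge \<open>{a, b}\<close> is the pair of arcs \<open>(a, b)\<close>, \<open>(b, a)\<close>.
\<close>

text \<open>
  The side condition \<open>a \<noteq> b\<close> only matters for \<open>n = 1\<close>, where \<open>{n, 1}\<close> is not an edge, and
  \<open>a, b \<in> {1..n}\<close> only for \<open>n = 0\<close>. For \<open>n = 2\<close> the graph is a single edge.
\<close>
definition cycle_graph :: "nat \<Rightarrow> nat pair_pre_digraph" where
  "cycle_graph n =
    \<lparr> pverts = {1..n},
      parcs = {(a, b). a \<in> {1..n} \<and> b \<in> {1..n} \<and> a \<noteq> b \<and>
                 ((\<exists>i\<in>{1..n - 1}. {a, b} = {i, i + 1}) \<or> {a, b} = {n, 1})} \<rparr>"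

text \<open>
  Bijections are taken to be extensional (\<open>undefined\<close> outside \<open>V(X)\<close>), so that each bijection
  between the vertex sets is represented by exactly one HOL function.
\<close>
definition bijections :: "'a set \<Rightarrow> 'b set \<Rightarrow> ('a \<Rightarrow> 'b) set" where
  "bijections A B = {\<sigma> \<in> extensional A. bij_betw \<sigma> A B}"

text \<open>The friends-and-strangers graph.\<close>
definition FS :: "'a pair_pre_digraph \<Rightarrow> 'b pair_pre_digraph \<Rightarrow> ('a \<Rightarrow> 'b) pair_pre_digraph" where
  "FS X Y =
    \<lparr> pverts = bijections (pverts X) (pverts Y),
      parcs = {(\<sigma>, \<tau>). \<sigma> \<in> bijections (pverts X) (pverts Y) \<and>
                 \<tau> \<in> bijections (pverts X) (pverts Y) \<and>
                 (\<exists>(a, b) \<in> parcs X. (\<sigma> a, \<sigma> b) \<in> parcs Y \<and> \<tau> a = \<sigma> b \<and> \<tau> b = \<sigma> a \<and>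
                    (\<forall>c \<in> pverts X - {a, b}. \<tau> c = \<sigma> c))} \<rparr>"

definition connected_component ::
  "('a, 'b) pre_digraph \<Rightarrow> ('a, 'b) pre_digraph \<Rightarrow> bool" where
  "connected_component G C \<longleftrightarrow> pre_digraph.max_subgraph G connected C"

text \<open>
  The shortest-path distance with unit weights is the graph distance. It is extended-real valued
  (\<open>\<infinity>\<close> if there is no walk), so the supremum needs no boundedness assumption.
\<close>
definition graph_diameter :: "('a, 'b) pre_digraph \<Rightarrow> ereal" where
  "graph_diameter G = (SUP u\<in>verts G. SUP v\<in>verts G. wf_digraph.\<mu> G (\<lambda>_. 1) u v)"

lemma pair_graph_cycle_graph: "pair_graph (cycle_graph n)"
proof -
  have "finite (parcs (cycle_graph n))"
    by (rule finite_subset[of _ "{1..n} \<times> {1..n}"]) (auto simp: cycle_graph_def)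
  moreover have "sym (parcs (cycle_graph n))"
    unfolding sym_def cycle_graph_def by (auto simp: insert_commute)
  ultimately show ?thesis
    by unfold_locales (auto simp: cycle_graph_def symmetric_def)
qed

lemma pair_graph_FS:
  assumes X: "pair_graph X" and Y: "pair_graph Y"
  shows "pair_graph (FS X Y)"
proof -
  interpret X: pair_graph X by (rule X)
  interpret Y: pair_graph Y by (rule Y)
  have sub: "bijections (pverts X) (pverts Y) \<subseteq> (pverts X \<rightarrow>\<^sub>E pverts Y)"
    by (auto simp: bijections_def PiE_def bij_betw_def)
  have fin: "finite (bijections (pverts X) (pverts Y))"
    by (rule finite_subset[OF sub]) (auto intro: finite_PiE X.pair_finite_verts Y.pair_finite_verts)
  have fin': "finite (parcs (FS X Y))"
    by (rule finite_subset[of _ "bijections (pverts X) (pverts Y) \<times> bijections (pverts X) (pverts Y)"])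
       (auto simp: FS_def fin)
  have symY: "(v, u) \<in> parcs Y" if "(u, v) \<in> parcs Y" for u v
    using Y.pair_sym_arcs that by (auto simp: symmetric_def sym_def)
  have symFS: "sym (parcs (FS X Y))"
  proof (rule symI)
    fix \<sigma> \<tau> assume st: "(\<sigma>, \<tau>) \<in> parcs (FS X Y)"
    then obtain a b where ab: "(a, b) \<in> parcs X" "(\<sigma> a, \<sigma> b) \<in> parcs Y" "\<tau> a = \<sigma> b" "\<tau> b = \<sigma> a"
      "\<forall>c \<in> pverts X - {a, b}. \<tau> c = \<sigma> c"
      by (auto simp: FS_def)
    have "(\<tau> a, \<tau> b) \<in> parcs Y" "\<forall>c \<in> pverts X - {a, b}. \<sigma> c = \<tau> c"
      using symY[OF ab(2)] ab(3-5) by simp_all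
    then have "\<exists>(a, b) \<in> parcs X. (\<tau> a, \<tau> b) \<in> parcs Y \<and> \<sigma> a = \<tau> b \<and> \<sigma> b = \<tau> a \<and>
        (\<forall>c \<in> pverts X - {a, b}. \<sigma> c = \<tau> c)"
      using ab(1,3,4) by (intro bexI[of _ "(a, b)"]) simp_all
    with st show "(\<tau>, \<sigma>) \<in> parcs (FS X Y)"
      by (simp add: FS_def)
  qed
  have loop: "\<sigma> \<noteq> \<tau>" if st: "(\<sigma>, \<tau>) \<in> parcs (FS X Y)" for \<sigma> \<tau>
  proof
    assume eq: "\<sigma> = \<tau>"
    from st obtain a b where ab: "(\<sigma> a, \<sigma> b) \<in> parcs Y" "\<tau> a = \<sigma> b"
      by (auto simp: FS_def)
    from ab(2) have "\<sigma> a = \<sigma> b"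
      by (simp only: eq)
    with Y.pair_no_loops[OF ab(1)] show False
      by simp
  qed
  have verts: "\<sigma> \<in> pverts (FS X Y)" "\<tau> \<in> pverts (FS X Y)" if "(\<sigma>, \<tau>) \<in> parcs (FS X Y)" for \<sigma> \<tau>
    using that by (simp_all add: FS_def)
  have "finite (pverts (FS X Y))"
    using fin by (simp add: FS_def)
  then show ?thesis
    using fin' symFS loop verts by unfold_locales (auto simp: symmetric_def)
qed

end

theory Submission
  imports Defs
begin

text \<open>
  Unroll the cycle: a bijection lifts to positions \<open>x v \<in> \<int>\<close>, pairwise distinct modulo \<open>n\<close>, and a
  friendly swap moves one person by \<open>+1\<close> and the next one by \<open>-1\<close>. It preserves the sum of all
  positions, and it changes \<open>\<lfloor>(x u - x v) / n\<rfloor>\<close> only for the two people swapped; so these winding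
  numbers are invariant for strangers. Conversely, two lifts with the same sum and the same winding
  numbers of strangers are joined by a walk along which every step corrects the winding number of
  one pair, as for geodesics of the affine symmetric group. It remains to choose, among the lifts of
  the target bijection, one close to the given lift of the source. Adding \<open>n c\<close> to a lift is allowed
  when \<open>c\<close> is constant on the components of the stranger graph and has sum zero; inside such a
  component all displacements differ by \<open>O(n\<^sup>3)\<close>, and reducing them modulo the size of
  one fixed component yields a walk of length at most \<open>4 n\<^sup>4 + 4 n\<^sup>3 + n\<^sup>2 - n \<le> 8 n\<^sup>4\<close>,
  so that even \<open>\<epsilon> = 0\<close> works.
\<close>

section \<open>Integer division and lifted swaps\<close>

text \<open>Adding one carries into the quotient only from remainder \<open>n - 1\<close>, that is,
  when \<open>a + 1\<close> is a multiple of \<open>n\<close>.\<close>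

lemma div_plus_one_eq:
  fixes a n :: int
  assumes "n > 0" "\<not> n dvd a + 1"
  shows "(a + 1) div n = a div n"
proof (rule int_div_pos_eq)
  show "a + 1 = n * (a div n) + (a mod n + 1)"
    by simp
  show "0 \<le> a mod n + 1"
    using assms(1) pos_mod_sign[of n a] by linarith
  have "a mod n + 1 \<noteq> n"
  proof
    assume "a mod n + 1 = n"
    then have "a + 1 = n * (a div n) + n"
      using mult_div_mod_eq[of n a] by linarith
    then show False
      using assms(2) by simp
  qed
  then show "a mod n + 1 < n"
    using assms(1) pos_mod_bound[of n a] by linarith
qed

text \<open>Passing from the numbers to \<open>n\<close> times their quotients drops two remainders,
  which differ by at most \<open>n - 1\<close>.\<close>

lemma div_diff_bound:
  fixes a b n :: int
  assumes "n > 0"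
  shows "n * (b div n - a div n) \<le> \<bar>b - a\<bar> + (n - 1)"
proof -
  have "b mod n \<ge> 0" "a mod n < n"
    using assms by simp_all
  then show ?thesis
    using mult_div_mod_eq[of n a] mult_div_mod_eq[of n b] unfolding right_diff_distrib by linarith
qed

lemma div_eq_imp_diff_less:
  fixes a b n :: int
  assumes "n > 0" "a div n = b div n"
  shows "\<bar>a - b\<bar> \<le> n - 1"
proof -
  have "a mod n \<ge> 0" "a mod n < n" "b mod n \<ge> 0" "b mod n < n"
    using assms(1) by simp_all
  moreover have "n * (a div n) = n * (b div n)"
    using assms(2) by simp
  ultimately show ?thesis
    using mult_div_mod_eq[of n a] mult_div_mod_eq[of n b] by linarith
qed

definition swap :: "'v \<Rightarrow> 'v \<Rightarrow> ('v \<Rightarrow> int) \<Rightarrow> 'v \<Rightarrow> int" where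
  "swap u w x = x(u := x u + 1, w := x w - 1)"

lemma sum_swap:
  assumes "finite V" "u \<in> V" "w \<in> V" "u \<noteq> w"
  shows "sum (swap u w x) V = sum x V"
proof -
  have split: "sum f V = f u + (f w + sum f (V - {u} - {w}))" for f :: "'a \<Rightarrow> int"
    using assms sum.remove[of V u f] sum.remove[of "V - {u}" w f] by auto
  have "sum (swap u w x) (V - {u} - {w}) = sum x (V - {u} - {w})"
    by (rule sum.cong) (auto simp: swap_def)
  then show ?thesis
    using assms(4) split[of "swap u w x"] split[of x] by (simp add: swap_def)
qed

text \<open>For any pair other than the swapped one the difference changes by at most one. Its
  quotient could change only if the larger of the old and new difference were divisible by
  \<open>n\<close>, and then two distinct people would share a residue.\<close>

lemma swap_div_eq:
  fixes n :: int
  assumes n: "n > 0"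
    and distinct: "\<And>p q. p \<in> V \<Longrightarrow> q \<in> V \<Longrightarrow> p \<noteq> q \<Longrightarrow> \<not> n dvd x p - x q"
    and uw: "u \<in> V" "w \<in> V" "u \<noteq> w" "n dvd x u + 1 - x w"
    and pq: "p \<in> V" "q \<in> V" "p \<noteq> q" "(p, q) \<noteq> (u, w)" "(p, q) \<noteq> (w, u)"
  shows "(swap u w x p - swap u w x q) div n = (x p - x q) div n"
proof -
  consider "p = u" "q \<noteq> w" | "p = w" "q \<noteq> u" | "q = u" "p \<noteq> w" | "q = w" "p \<noteq> u"
    | "p \<notin> {u, w}" "q \<notin> {u, w}"
    using pq by blast
  then show ?thesis
  proof cases
    case 1
    have "\<not> n dvd (x p - x q) + 1"
    proof
      assume "n dvd (x p - x q) + 1"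
      then have "n dvd (x u + 1 - x w) - ((x p - x q) + 1)"
        using uw(4) by (rule dvd_diff[rotated])
      then show False
        using 1 distinct[of q w] pq uw by simp
    qed
    from div_plus_one_eq[OF n this] show ?thesis
      using 1 pq uw by (simp add: swap_def algebra_simps)
  next
    case 2
    have "\<not> n dvd (x p - x q - 1) + 1"
      using distinct[of p q] pq by simp
    from div_plus_one_eq[OF n this] show ?thesis
      using 2 pq uw by (simp add: swap_def algebra_simps)
  next
    case 3
    have "\<not> n dvd (x p - x q - 1) + 1"
      using distinct[of p q] pq by simp
    from div_plus_one_eq[OF n this] show ?thesis
      using 3 pq uw by (simp add: swap_def algebra_simps)
  next
    case 4
    have "\<not> n dvd (x p - x q) + 1"
    proof
      assume "n dvd (x p - x q) + 1"
      then have "n dvd ((x p - x q) + 1) - (x u + 1 - x w)"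
        using uw(4) by (rule dvd_diff)
      then show False
        using 4 distinct[of p u] pq uw by simp
    qed
    from div_plus_one_eq[OF n this] show ?thesis
      using 4 pq uw by (simp add: swap_def algebra_simps)
  next
    case 5
    then show ?thesis
      by (simp add: swap_def)
  qed
qed

section \<open>Reducing a displacement\<close>

lemma relpow_diff_bound:
  fixes d :: "'v \<Rightarrow> int"
  assumes "(u, v) \<in> S ^^ k" "\<And>u v. (u, v) \<in> S \<Longrightarrow> \<bar>d u - d v\<bar> \<le> m"
  shows "\<bar>d u - d v\<bar> \<le> int k * m"
  using assms(1)
proof (induction k arbitrary: v)
  case (Suc k)
  then obtain w where w: "(u, w) \<in> S ^^ k" "(w, v) \<in> S"
    by auto
  have "\<bar>d u - d v\<bar> \<le> \<bar>d u - d w\<bar> + \<bar>d w - d v\<bar>"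
    by linarith
  also have "\<dots> \<le> int k * m + m"
    using Suc.IH[OF w(1)] assms(2)[OF w(2)] by linarith
  finally show ?case
    by (simp add: algebra_simps)
qed simp

text \<open>
  The correction \<open>c\<close> solves \<open>\<Sum>v. c v = 0\<close> while keeping the multiples \<open>e v\<close> of \<open>n\<close> small: on all
  classes but one, \<open>e v\<close> is reduced modulo the size \<open>M\<close> of the remaining class \<open>P\<close>; the total change
  is then a multiple of \<open>M\<close>, so a constant on \<open>P\<close> can absorb it.
\<close>
lemma small_displacement:
  fixes d :: "'v \<Rightarrow> int" and n :: nat
  assumes V: "finite V" "card V = n" "n > 0" and S: "S \<subseteq> V \<times> V" "sym S"
    and d: "\<And>u v. (u, v) \<in> S \<Longrightarrow> \<bar>d u - d v\<bar> \<le> int n - 1" "sum d V = 0"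
  shows "\<exists>c. sum c V = 0 \<and> (\<forall>u v. (u, v) \<in> S \<longrightarrow> c u = c v) \<and>
    (\<Sum>v\<in>V. \<bar>d v + int n * c v\<bar>) \<le> 2 * int n ^ 4 + 2 * int n ^ 3"
proof -
  define cls where "cls v = {w \<in> V. (v, w) \<in> S\<^sup>*}" for v
  \<comment> \<open>Rounding \<open>d\<close> at a chosen representative, not at \<open>v\<close>
    itself, makes \<open>e\<close> constant on classes.\<close>
  define e where "e v = d (SOME w. w \<in> cls v) div int n" for v
  have cls_refl: "v \<in> cls v" if "v \<in> V" for v
    using that by (simp add: cls_def)
  have cls_eq: "cls u = cls v" if "(u, v) \<in> S\<^sup>*" for u v
    using that sym_rtrancl[OF S(2)] unfolding cls_def by (blast dest: symD intro: rtrancl_trans)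
  have fin_S: "finite S"
    using V(1) S(1) by (meson finite_SigmaI finite_subset)
  have card_S: "card S \<le> n\<^sup>2"
    using card_mono[OF _ S(1)] V by (simp add: card_cartesian_product power2_eq_square)
  \<comment> \<open>A path inside a class has at most \<open>card S \<le> n^2\<close> steps of size
    at most \<open>n - 1\<close>, costing \<open>n^3 - n^2\<close>; rounding costs less than
    \<open>n \<le> n^2\<close>.\<close>
  have close: "\<bar>d v - int n * e v\<bar> \<le> int n ^ 3" if "v \<in> V" for v
  proof -
    define r where "r = (SOME w. w \<in> cls v)"
    have "r \<in> cls v"
      unfolding r_def using cls_refl[OF that] by (rule someI)
    then obtain k where k: "k \<le> card S" "(v, r) \<in> S ^^ k"
      using rtrancl_finite_eq_relpow[OF fin_S] by (auto simp: cls_def)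
    have "\<bar>d v - d r\<bar> \<le> int k * (int n - 1)"
      using k(2) d(1) by (rule relpow_diff_bound)
    also have "\<dots> \<le> int n ^ 2 * (int n - 1)"
      using k(1) card_S V(3) by (intro mult_right_mono) (auto simp flip: of_nat_power)
    finally have "\<bar>d v - d r\<bar> \<le> int n ^ 3 - int n ^ 2"
      by (simp add: algebra_simps power_numeral_reduce)
    moreover have "int n * e v + d r mod int n = d r" "0 \<le> d r mod int n" "d r mod int n < int n"
      using V(3) by (simp_all add: e_def r_def)
    moreover have "int n \<le> int n ^ 2"
      using V(3) by (simp add: power2_eq_square)
    ultimately show ?thesis
      by linarith
  qed
  obtain p where p: "p \<in> V"
    using V by (metis card.empty equals0I less_irrefl)
  define P where "P = cls p"
  define M where "M = int (card P)"
  have P: "P \<subseteq> V" "finite P" "p \<in> P"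
    using V(1) p cls_refl by (auto simp: P_def cls_def)
  have M: "M > 0" "M \<le> int n"
    using P V card_mono[OF V(1) P(1)] by (auto simp: M_def card_gt_0_iff)
  \<comment> \<open>\<open>\<kappa>\<close> counts the multiples of \<open>M\<close> removed outside
    \<open>P\<close>. Adding it at each of the \<open>M\<close> elements of \<open>P\<close> makes
    the total change zero.\<close>
  define \<kappa> where "\<kappa> = (\<Sum>v\<in>V - P. e v div M)"
  define c where "c v = (if v \<in> P then \<kappa> else - M * (e v div M))" for v
  define f where "f v = e v + c v" for v
  have split: "sum g V = sum g P + sum g (V - P)" for g :: "'v \<Rightarrow> int"
    using sum.subset_diff[OF P(1) V(1)] by (simp add: add.commute)
  have "sum c P = M * \<kappa>" "sum c (V - P) = - (M * \<kappa>)"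
    by (simp_all add: c_def M_def \<kappa>_def sum_distrib_left sum_negf)
  then have sum_c: "sum c V = 0"
    using split by simp
  have c_const: "c u = c v" if "(u, v) \<in> S" for u v
  proof -
    have "cls u = cls v"
      using that by (intro cls_eq) auto
    moreover have "u \<in> P \<longleftrightarrow> v \<in> P"
    proof -
      have "(v, u) \<in> S"
        using that S(2) by (rule symD[rotated])
      then show ?thesis
        using that S(1) unfolding P_def cls_def by (blast intro: rtrancl_into_rtrancl)
    qed
    ultimately show ?thesis
      by (simp add: c_def e_def)
  qed
  have f_P: "f v = f p" if "v \<in> P" for v
  proof -
    have "cls v = cls p"
      using that by (intro cls_eq[symmetric]) (simp add: P_def cls_def)
    then show ?thesis
      using that P(3) by (simp add: f_def c_def e_def)
  qed
  have f_outside: "\<bar>f v\<bar> \<le> int n" if "v \<in> V - P" for v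
  proof -
    have "f v = e v mod M"
      using that by (simp add: f_def c_def minus_mult_div_eq_mod[symmetric])
    then show ?thesis
      using M pos_mod_sign[of M "e v"] pos_mod_bound[of M "e v"] by linarith
  qed
  have "(\<Sum>v\<in>V - P. \<bar>f v\<bar>) \<le> (\<Sum>v\<in>V - P. int n)"
    using f_outside by (rule sum_mono)
  also have "\<dots> \<le> int n * int n"
    using V card_mono[OF V(1), of "V - P"] by (simp add: mult_right_mono)
  finally have outside: "(\<Sum>v\<in>V - P. \<bar>f v\<bar>) \<le> int n ^ 2"
    by (simp add: power2_eq_square)
  have inside: "sum f P = M * f p" "(\<Sum>v\<in>P. \<bar>f v\<bar>) = \<bar>M * f p\<bar>"
    using f_P M by (simp_all add: M_def abs_mult)
  have sum_n: "(\<Sum>v\<in>V. int n ^ k) = int n ^ Suc k" for k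
    using V(2) by simp
  \<comment> \<open>Since \<open>d\<close> sums to zero, \<open>n * sum e V\<close> is up to sign
    the total rounding error, made of \<open>n\<close> terms bounded by
    \<open>close\<close>.\<close>
  have sum_e: "\<bar>sum e V\<bar> \<le> int n ^ 3"
  proof -
    have "int n * \<bar>sum e V\<bar> = \<bar>\<Sum>v\<in>V. d v - int n * e v\<bar>"
      using d(2) by (simp add: sum_subtractf abs_mult flip: sum_distrib_left)
    also have "\<dots> \<le> (\<Sum>v\<in>V. \<bar>d v - int n * e v\<bar>)"
      by (rule sum_abs)
    also have "\<dots> \<le> (\<Sum>v\<in>V. int n ^ 3)"
      using close by (rule sum_mono)
    finally have "int n * \<bar>sum e V\<bar> \<le> int n * int n ^ 3"
      unfolding sum_n power_Suc .
    then show ?thesis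
      using V(3) by (simp del: power_Suc)
  qed
  \<comment> \<open>The value of \<open>f\<close> on \<open>P\<close> has no direct bound; it is
    recovered from the total by subtracting the part outside \<open>P\<close>.\<close>
  have "sum f V = sum e V"
    using sum_c by (simp add: f_def sum.distrib)
  then have "\<bar>M * f p\<bar> \<le> int n ^ 3 + int n ^ 2"
    using sum_e outside split[of f] inside(1) sum_abs[of f "V - P"] by linarith
  then have sum_f: "(\<Sum>v\<in>V. \<bar>f v\<bar>) \<le> int n ^ 3 + 2 * int n ^ 2"
    using split[of "\<lambda>v. \<bar>f v\<bar>"] inside(2) outside by linarith
  have "(\<Sum>v\<in>V. \<bar>d v + int n * c v\<bar>) \<le> (\<Sum>v\<in>V. int n ^ 3 + int n * \<bar>f v\<bar>)"
  proof (rule sum_mono)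
    fix v assume "v \<in> V"
    have "d v + int n * c v = (d v - int n * e v) + int n * f v"
      by (simp add: f_def algebra_simps)
    also have "\<bar>\<dots>\<bar> \<le> \<bar>d v - int n * e v\<bar> + \<bar>int n * f v\<bar>"
      by (rule abs_triangle_ineq)
    finally show "\<bar>d v + int n * c v\<bar> \<le> int n ^ 3 + int n * \<bar>f v\<bar>"
      using close[OF \<open>v \<in> V\<close>] by (simp add: abs_mult)
  qed
  also have "\<dots> = int n ^ 4 + int n * (\<Sum>v\<in>V. \<bar>f v\<bar>)"
    unfolding sum.distrib sum_n by (simp add: sum_distrib_left)
  also have "\<dots> \<le> int n ^ 4 + int n * (int n ^ 3 + 2 * int n ^ 2)"
    using sum_f by (intro add_left_mono mult_left_mono) simp_all
  finally have "(\<Sum>v\<in>V. \<bar>d v + int n * c v\<bar>) \<le> 2 * int n ^ 4 + 2 * int n ^ 3"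
    by (simp add: algebra_simps power_numeral_reduce)
  with sum_c c_const show ?thesis
    by blast
qed

section \<open>Lifts of bijections\<close>

text \<open>Going once around the cycle returns to the start, so no step can be strict.\<close>

lemma nondecreasing_around_cycle:
  fixes g :: "nat \<Rightarrow> int"
  assumes step: "\<And>i. 1 \<le> i \<Longrightarrow> i < n \<Longrightarrow> g i \<le> g (i + 1)" and wrap: "g n \<le> g 1"
    and i: "1 \<le> i" "i \<le> n"
  shows "g i = g 1"
proof -
  have "g 1 \<le> g i"
    using i by (induction i rule: dec_induct) (use step in force)+
  moreover have "g i \<le> g n"
    using i(2,1) by (induction i rule: inc_induct) (use step in force)+
  ultimately show ?thesis
    using wrap by linarith
qed

definition succ_mod :: "nat \<Rightarrow> nat \<Rightarrow> nat" where
  "succ_mod n i = (if i = n then 1 else i + 1)"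

lemma succ_mod_in: "i \<in> {1..n} \<Longrightarrow> succ_mod n i \<in> {1..n}"
  by (auto simp: succ_mod_def)

lemma succ_mod_dvd: "int n dvd int i + 1 - int (succ_mod n i)"
  by (auto simp: succ_mod_def)

text \<open>For \<open>n = 1\<close> the successor of 1 is 1 itself, and \<open>a \<noteq> b\<close>
  removes this loop.\<close>

lemma parcs_cycle_graph_iff:
  "(a, b) \<in> parcs (cycle_graph n) \<longleftrightarrow>
     a \<in> {1..n} \<and> b \<in> {1..n} \<and> a \<noteq> b \<and> (b = succ_mod n a \<or> a = succ_mod n b)"
  unfolding cycle_graph_def succ_mod_def by (auto simp: doubleton_eq_iff)

section \<open>Lifts, their invariants and the deficit\<close>

locale fs_cycle =
  fixes Y :: "'v pair_pre_digraph" and n :: nat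
  assumes graph: "pair_graph Y" and card_verts: "card (pverts Y) = n"
begin

abbreviation "V \<equiv> pverts Y"

abbreviation "B \<equiv> bijections {1..n} V"

abbreviation "R \<equiv> parcs (FS (cycle_graph n) Y)"

definition strangers :: "('v \<times> 'v) set" where
  "strangers = {(u, v). u \<in> V \<and> v \<in> V \<and> u \<noteq> v \<and> (u, v) \<notin> parcs Y}"

text \<open>
  The positions on the cycle are unrolled to the integers: \<open>x v\<close> is the position of \<open>v\<close> together
  with a count of how often \<open>v\<close> has travelled around the cycle.
\<close>
definition is_lift :: "(nat \<Rightarrow> 'v) \<Rightarrow> ('v \<Rightarrow> int) \<Rightarrow> bool" where
  "is_lift \<sigma> x \<longleftrightarrow> (\<forall>i\<in>{1..n}. int n dvd x (\<sigma> i) - int i)"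

text \<open>The two invariants of a walk: \<open>lift_walk\<close> shows that they are necessary,
  \<open>walk_between_lifts\<close> that they are sufficient.\<close>

definition compatible_lifts :: "('v \<Rightarrow> int) \<Rightarrow> ('v \<Rightarrow> int) \<Rightarrow> bool" where
  "compatible_lifts x y \<longleftrightarrow> sum x V = sum y V \<and>
     (\<forall>(u, v)\<in>strangers. (x u - x v) div int n = (y u - y v) div int n)"

text \<open>The truncation by \<open>nat\<close> loses nothing for lifts: differences of distinct
  people are not divisible by \<open>n\<close>, so an excess at \<open>(u, v)\<close> is a deficit
  at \<open>(v, u)\<close>. The sum thus counts the hyperplanes of the affine arrangement that
  separate \<open>x\<close> from \<open>y\<close>.\<close>

definition deficit :: "('v \<Rightarrow> int) \<Rightarrow> ('v \<Rightarrow> int) \<Rightarrow> nat" where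
  "deficit x y = (\<Sum>(u, v)\<in>V \<times> V. nat ((y u - y v) div int n - (x u - x v) div int n))"

lemma finite_V: "finite V"
  using graph by (simp add: pair_graph_def pair_digraph_def pair_fin_digraph.pair_finite_verts)

lemma sym_Y: "(u, v) \<in> parcs Y \<Longrightarrow> (v, u) \<in> parcs Y"
proof -
  interpret pair_graph Y by (rule graph)
  show "(u, v) \<in> parcs Y \<Longrightarrow> (v, u) \<in> parcs Y"
    using pair_sym_arcs by (auto simp: symmetric_def sym_def)
qed

lemma bij_image:
  assumes "\<sigma> \<in> B"
  shows "\<sigma> ` {1..n} = V" "inj_on \<sigma> {1..n}"
  using assms by (auto simp: bijections_def bij_betw_def)

lemma bij_obtain:
  assumes "\<sigma> \<in> B" "v \<in> V"
  obtains i where "i \<in> {1..n}" "\<sigma> i = v"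
  using bij_image(1)[OF assms(1)] assms(2) by (metis imageE)

lemma residue_unique:
  assumes "i \<in> {1..n}" "j \<in> {1..n}" "int n dvd int i - int j"
  shows "i = j"
proof (rule ccontr)
  assume "i \<noteq> j"
  then have "int n \<le> \<bar>int i - int j\<bar>"
    using assms(3) by (intro zdvd_imp_le) auto
  then show False
    using assms(1,2) by auto
qed

lemma is_liftD: "is_lift \<sigma> x \<Longrightarrow> i \<in> {1..n} \<Longrightarrow> int n dvd x (\<sigma> i) - int i"
  by (simp add: is_lift_def)

lemma lift_distinct:
  assumes "\<sigma> \<in> B" "is_lift \<sigma> x" "p \<in> V" "q \<in> V" "p \<noteq> q"
  shows "\<not> int n dvd x p - x q"
proof
  assume dvd: "int n dvd x p - x q"
  obtain i j where ij: "i \<in> {1..n}" "\<sigma> i = p" "j \<in> {1..n}" "\<sigma> j = q"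
    using assms(1,3,4) by (metis bij_obtain)
  have "int n dvd (x p - x q) - (x p - int i) + (x q - int j)"
    using is_liftD[OF assms(2) ij(1), unfolded ij(2)] is_liftD[OF assms(2) ij(3), unfolded ij(4)]
    by (intro dvd_add[OF dvd_diff[OF dvd]])
  then have "i = j"
    using ij by (intro residue_unique) simp_all
  then show False
    using ij assms(5) by simp
qed

lemma lift_unique:
  assumes "\<sigma> \<in> B" "\<tau> \<in> B" "is_lift \<sigma> x" "is_lift \<tau> y" "\<And>v. v \<in> V \<Longrightarrow> x v = y v"
  shows "\<sigma> = \<tau>"
proof (rule extensionalityI[where A = "{1..n}"])
  show "\<sigma> \<in> extensional {1..n}" "\<tau> \<in> extensional {1..n}"
    using assms(1,2) by (auto simp: bijections_def)
  fix i assume i: "i \<in> {1..n}"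
  then have "\<sigma> i \<in> V"
    using bij_image(1)[OF assms(1)] by blast
  then obtain j where j: "j \<in> {1..n}" "\<tau> j = \<sigma> i"
    using assms(2) by (metis bij_obtain)
  have "int n dvd (y (\<tau> j) - int j) - (x (\<sigma> i) - int i)"
    by (intro dvd_diff is_liftD[OF assms(3) i] is_liftD[OF assms(4) j(1)])
  then have "i = j"
    using i j assms(5)[OF \<open>\<sigma> i \<in> V\<close>] by (intro residue_unique) auto
  then show "\<sigma> i = \<tau> i"
    using j by simp
qed

lemma ex_lift:
  assumes "\<sigma> \<in> B"
  shows "\<exists>x. is_lift \<sigma> x"
proof
  show "is_lift \<sigma> (\<lambda>v. int (the_inv_into {1..n} \<sigma> v))"
    using bij_image(2)[OF assms] by (auto simp: is_lift_def the_inv_into_f_f)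
qed

section \<open>Effect of a swap on lifts\<close>

text \<open>All conditions are modulo \<open>n\<close>, so the edge from \<open>n\<close> to 1 needs
  no separate treatment: the lift just leaves the window from 1 to \<open>n\<close>.\<close>

lemma is_lift_swap:
  assumes "\<sigma> \<in> B" "is_lift \<sigma> x" and a: "a \<in> {1..n}" and b: "b = succ_mod n a" "a \<noteq> b"
    and \<tau>: "\<tau> a = \<sigma> b" "\<tau> b = \<sigma> a" "\<And>c. c \<in> {1..n} - {a, b} \<Longrightarrow> \<tau> c = \<sigma> c"
  shows "is_lift \<tau> (swap (\<sigma> a) (\<sigma> b) x)" "int n dvd x (\<sigma> a) + 1 - x (\<sigma> b)" "\<sigma> a \<noteq> \<sigma> b"
proof -
  have b': "b \<in> {1..n}"
    using a b succ_mod_in by blast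
  have inj: "\<sigma> i = \<sigma> j \<longleftrightarrow> i = j" if "i \<in> {1..n}" "j \<in> {1..n}" for i j
    using bij_image(2)[OF assms(1)] that by (rule inj_on_eq_iff)
  have da: "int n dvd x (\<sigma> a) - int a" and db: "int n dvd x (\<sigma> b) - int b"
    using assms(2) a b' by (auto simp: is_lift_def)
  have ab: "int n dvd int a + 1 - int b"
    using b succ_mod_dvd by simp
  show "\<sigma> a \<noteq> \<sigma> b"
    using inj a b' b(2) by simp
  have "int n dvd (x (\<sigma> a) - int a) - (x (\<sigma> b) - int b) + (int a + 1 - int b)"
    by (intro dvd_add dvd_diff da db ab)
  then show "int n dvd x (\<sigma> a) + 1 - x (\<sigma> b)"
    by (simp add: algebra_simps)
  show "is_lift \<tau> (swap (\<sigma> a) (\<sigma> b) x)"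
    unfolding is_lift_def
  proof
    fix i assume i: "i \<in> {1..n}"
    consider "i = a" | "i = b" | "i \<noteq> a" "i \<noteq> b"
      by blast
    then show "int n dvd swap (\<sigma> a) (\<sigma> b) x (\<tau> i) - int i"
    proof cases
      case 1
      have "int n dvd (x (\<sigma> b) - int b) - (int a + 1 - int b)"
        by (intro dvd_diff db ab)
      then show ?thesis
        using 1 \<tau> inj a b' b(2) by (simp add: swap_def algebra_simps)
    next
      case 2
      have "int n dvd (x (\<sigma> a) - int a) + (int a + 1 - int b)"
        by (intro dvd_add da ab)
      then show ?thesis
        using 2 \<tau> inj a b' b(2) by (simp add: swap_def algebra_simps)
    next
      case 3
      then show ?thesis
        using \<tau>(3)[of i] i inj a b' assms(2) by (auto simp: swap_def is_lift_def)
    qed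
  qed
qed

text \<open>By \<open>swap_div_eq\<close> only the winding numbers of \<open>u\<close> and
  \<open>w\<close> relative to each other can change, and these two are friends.\<close>

lemma compatible_swap:
  assumes "\<sigma> \<in> B" "is_lift \<sigma> x" "(u, w) \<in> parcs Y" "u \<in> V" "w \<in> V" "u \<noteq> w"
    and "int n dvd x u + 1 - x w"
  shows "compatible_lifts (swap u w x) x"
proof -
  have "n > 0"
    using assms(4) card_verts finite_V by (auto simp: card_gt_0_iff)
  then have "(swap u w x p - swap u w x q) div int n = (x p - x q) div int n"
    if "(p, q) \<in> strangers" for p q
    using that assms(3-7) sym_Y[OF assms(3)] lift_distinct[OF assms(1,2)]
    by (intro swap_div_eq[where V = V]) (auto simp: strangers_def)
  then show ?thesis
    using sum_swap[OF finite_V assms(4-6)] by (auto simp: compatible_lifts_def)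
qed

text \<open>A swap is described symmetrically in \<open>a\<close> and \<open>b\<close>, as
  friendship is symmetric, so each edge can be oriented with \<open>b\<close> as the successor of
  \<open>a\<close>.\<close>

lemma R_iff:
  "(\<sigma>, \<tau>) \<in> R \<longleftrightarrow> \<sigma> \<in> B \<and> \<tau> \<in> B \<and>
     (\<exists>a\<in>{1..n}. \<exists>b. b = succ_mod n a \<and> a \<noteq> b \<and> (\<sigma> a, \<sigma> b) \<in> parcs Y \<and> \<tau> a = \<sigma> b \<and> \<tau> b = \<sigma> a \<and>
        (\<forall>c\<in>{1..n} - {a, b}. \<tau> c = \<sigma> c))"
    (is "_ \<longleftrightarrow> _ \<and> _ \<and> (\<exists>a\<in>_. \<exists>b. ?P a b)")
proof -
  have verts: "pverts (cycle_graph n) = {1..n}"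
    by (simp add: cycle_graph_def)
  have FS: "(\<sigma>, \<tau>) \<in> R \<longleftrightarrow> \<sigma> \<in> B \<and> \<tau> \<in> B \<and>
      (\<exists>(a, b)\<in>parcs (cycle_graph n). (\<sigma> a, \<sigma> b) \<in> parcs Y \<and> \<tau> a = \<sigma> b \<and> \<tau> b = \<sigma> a \<and>
        (\<forall>c\<in>{1..n} - {a, b}. \<tau> c = \<sigma> c))"
    by (simp add: FS_def verts)
  have "(\<exists>(a, b)\<in>parcs (cycle_graph n). (\<sigma> a, \<sigma> b) \<in> parcs Y \<and> \<tau> a = \<sigma> b \<and> \<tau> b = \<sigma> a \<and>
        (\<forall>c\<in>{1..n} - {a, b}. \<tau> c = \<sigma> c)) \<longleftrightarrow> (\<exists>a\<in>{1..n}. \<exists>b. ?P a b)" (is "?L \<longleftrightarrow> ?R")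
  proof
    assume ?L
    then obtain a b where ab: "(a, b) \<in> parcs (cycle_graph n)" "(\<sigma> a, \<sigma> b) \<in> parcs Y"
      "\<tau> a = \<sigma> b" "\<tau> b = \<sigma> a" "\<forall>c\<in>{1..n} - {a, b}. \<tau> c = \<sigma> c"
      by auto
    have "{b, a} = {a, b}"
      by auto
    then have "?P a b \<or> ?P b a"
      using ab sym_Y[OF ab(2)] unfolding parcs_cycle_graph_iff by metis
    then show ?R
      using ab(1) unfolding parcs_cycle_graph_iff by blast
  next
    assume ?R
    then obtain a b where "a \<in> {1..n}" "?P a b"
      by blast
    then show ?L
      using succ_mod_in[of a n] by (intro bexI[of _ "(a, b)"]) (auto simp: parcs_cycle_graph_iff)
  qed
  with FS show ?thesis
    by simp
qed

lemma compatible_lifts_trans: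
  "compatible_lifts x y \<Longrightarrow> compatible_lifts y z \<Longrightarrow> compatible_lifts x z"
  by (fastforce simp: compatible_lifts_def)

lemma compatible_lifts_sym: "compatible_lifts x y \<Longrightarrow> compatible_lifts y x"
  by (fastforce simp: compatible_lifts_def)

lemma lift_step:
  assumes "(\<sigma>, \<tau>) \<in> R" "is_lift \<sigma> x"
  shows "\<exists>y. is_lift \<tau> y \<and> compatible_lifts x y"
proof -
  obtain a b where ab: "\<sigma> \<in> B" "a \<in> {1..n}" "b = succ_mod n a" "a \<noteq> b" "(\<sigma> a, \<sigma> b) \<in> parcs Y"
    "\<tau> a = \<sigma> b" "\<tau> b = \<sigma> a" "\<And>c. c \<in> {1..n} - {a, b} \<Longrightarrow> \<tau> c = \<sigma> c"
    using assms(1) unfolding R_iff by blast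
  note lift = is_lift_swap[OF ab(1) assms(2) ab(2-4,6-8)]
  have "\<sigma> a \<in> V" "\<sigma> b \<in> V"
    using bij_image(1)[OF ab(1)] ab(2,3) succ_mod_in by blast+
  then have "compatible_lifts x (swap (\<sigma> a) (\<sigma> b) x)"
    by (rule compatible_lifts_sym[OF compatible_swap[OF ab(1) assms(2) ab(5) _ _ lift(3,2)]])
  with lift(1) show ?thesis
    by blast
qed

text \<open>The walk is lifted step by step. The resulting \<open>y\<close> may be far from
  \<open>x\<close>; it is replaced by a closer lift in \<open>short_walk\<close>.\<close>

lemma lift_walk:
  assumes "(\<sigma>, \<tau>) \<in> R\<^sup>*" "is_lift \<sigma> x"
  shows "\<exists>y. is_lift \<tau> y \<and> compatible_lifts x y"
  using assms(1)
proof (induction rule: rtrancl_induct)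
  case base
  then show ?case
    using assms(2) by (auto simp: compatible_lifts_def)
next
  case (step \<tau> \<tau>')
  then show ?case
    using lift_step compatible_lifts_trans by blast
qed

section \<open>Walks between compatible lifts\<close>

text \<open>A displacement that never drops around the cycle is constant, and equal sums make the
  constant zero. This is the terminal case of the walk construction.\<close>

lemma lift_eq_if_nondecreasing:
  fixes x y :: "'v \<Rightarrow> int"
  assumes "\<sigma> \<in> B" and sum: "sum x V = sum y V"
    and mono: "\<And>i. i \<in> {1..n} \<Longrightarrow> y (\<sigma> i) - x (\<sigma> i) \<le> y (\<sigma> (succ_mod n i)) - x (\<sigma> (succ_mod n i))"
    and v: "v \<in> V"
  shows "x v = y v"
proof -
  define g where "g i = y (\<sigma> i) - x (\<sigma> i)" for i
  have const: "g i = g 1" if i: "i \<in> {1..n}" for i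
  proof (rule nondecreasing_around_cycle[where g = g and n = n and i = i])
    show "g j \<le> g (j + 1)" if "1 \<le> j" "j < n" for j
      using mono[of j] that by (simp add: g_def succ_mod_def)
    show "g n \<le> g 1"
      using mono[of n] i by (simp add: g_def succ_mod_def)
  qed (use i in auto)
  have "bij_betw \<sigma> {1..n} V"
    using assms(1) by (simp add: bijections_def)
  then have "(\<Sum>v\<in>V. y v - x v) = (\<Sum>i\<in>{1..n}. g i)"
    unfolding g_def by (rule sum.reindex_bij_betw[symmetric])
  also have "\<dots> = (\<Sum>i\<in>{1..n}. g 1)"
    using const by (rule sum.cong[OF refl])
  finally have "int n * g 1 = 0"
    using sum by (simp add: sum_subtractf)
  moreover obtain i where i: "i \<in> {1..n}" "\<sigma> i = v"
    using assms(1) v by (rule bij_obtain)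
  ultimately have "g i = 0"
    using const[of i] by auto
  then show ?thesis
    using i by (simp add: g_def)
qed

text \<open>With \<open>x u + 1 - x w = n * k\<close>, the swap raises the winding number of
  \<open>(u, w)\<close> from \<open>k - 1\<close> to \<open>k\<close>, while the drop in
  displacement forces at least \<open>k\<close> in \<open>y\<close>. So this term falls by one; the
  term of \<open>(w, u)\<close> becomes zero, and all others stay. \<open>n \<ge> 2\<close> makes 1
  and \<open>n - 1\<close> valid remainders.\<close>

lemma deficit_swap_less:
  assumes n: "n \<ge> 2" and "\<sigma> \<in> B" "is_lift \<sigma> x" "\<tau> \<in> B" "is_lift \<tau> y"
    and uw: "u \<in> V" "w \<in> V" "u \<noteq> w" "int n dvd x u + 1 - x w"
    and less: "y w - x w < y u - x u"
  shows "deficit (swap u w x) y < deficit x y" "(x u - x w) div int n \<noteq> (y u - y w) div int n"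
proof -
  obtain k where k: "x u + 1 - x w = int n * k"
    using uw(4) by (elim dvdE)
  have xuw: "(x u - x w) div int n = k - 1"
    using k n by (intro int_div_pos_eq[where r = "int n - 1"]) (auto simp: algebra_simps)
  have xuw': "(swap u w x u - swap u w x w) div int n = k"
    using k n uw(3) by (intro int_div_pos_eq[where r = 1]) (auto simp: swap_def)
  have xwu': "(swap u w x w - swap u w x u) div int n = - k - 1"
    using k n uw(3)
    by (intro int_div_pos_eq[where r = "int n - 1"]) (auto simp: swap_def algebra_simps)
  have ge: "y u - y w \<ge> int n * k"
    using k less by linarith
  then have "k \<le> (y u - y w) div int n"
    using n zdiv_mono1[of "int n * k" "y u - y w" "int n"] by simp
  \<comment> \<open>Strictness is what bounds the reversed pair: \<open>(w, u)\<close> must have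
    winding number below \<open>- k\<close> in \<open>y\<close>.\<close>
  have "y u - y w \<noteq> int n * k"
    using lift_distinct[OF assms(4,5) uw(1-3)] by auto
  then have "y w - y u < int n * (- k)"
    using ge by simp
  moreover have "int n * ((y w - y u) div int n) \<le> y w - y u"
    using n mult_div_mod_eq[of "int n" "y w - y u"] pos_mod_sign[of "int n" "y w - y u"]
    by linarith
  ultimately have "int n * ((y w - y u) div int n) < int n * (- k)"
    by linarith
  then have "(y w - y u) div int n < - k"
    by (rule mult_left_less_imp_less) simp
  show "(x u - x w) div int n \<noteq> (y u - y w) div int n"
    using xuw \<open>k \<le> _\<close> by simp
  show "deficit (swap u w x) y < deficit x y"
    unfolding deficit_def
  proof (rule sum_strict_mono_ex1)
    show "finite (V \<times> V)"
      using finite_V by simp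
    show "\<exists>z\<in>V \<times> V.
        (case z of (p, q) \<Rightarrow> nat ((y p - y q) div int n - (swap u w x p - swap u w x q) div int n))
        < (case z of (p, q) \<Rightarrow> nat ((y p - y q) div int n - (x p - x q) div int n))"
      using uw xuw xuw' \<open>k \<le> _\<close> by (intro bexI[of _ "(u, w)"]) auto
    have "nat ((y p - y q) div int n - (swap u w x p - swap u w x q) div int n)
        \<le> nat ((y p - y q) div int n - (x p - x q) div int n)" if pq: "p \<in> V" "q \<in> V" for p q
    proof -
      consider "p = q" | "(p, q) = (u, w)" | "(p, q) = (w, u)"
        | "p \<noteq> q" "(p, q) \<noteq> (u, w)" "(p, q) \<noteq> (w, u)"
        by blast
      then show ?thesis
      proof cases
        case 4
        then have "(swap u w x p - swap u w x q) div int n = (x p - x q) div int n"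
          using n pq uw lift_distinct[OF assms(2,3)] by (intro swap_div_eq[where V = V]) auto
        then show ?thesis
          by simp
      qed (use xuw xuw' xwu' \<open>_ < - k\<close> in auto)
    qed
    then show "\<forall>z\<in>V \<times> V.
        (case z of (p, q) \<Rightarrow> nat ((y p - y q) div int n - (swap u w x p - swap u w x q) div int n))
        \<le> (case z of (p, q) \<Rightarrow> nat ((y p - y q) div int n - (x p - x q) div int n))"
      by auto
  qed
qed

lemma bij_swap:
  assumes "\<sigma> \<in> B" "a \<in> {1..n}" "b \<in> {1..n}"
  shows "\<sigma>(a := \<sigma> b, b := \<sigma> a) \<in> B"
proof -
  have "\<sigma>(a := \<sigma> b, b := \<sigma> a) = \<sigma> \<circ> Transposition.transpose a b"
    by (auto simp: Transposition.transpose_def)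
  then have "bij_betw (\<sigma>(a := \<sigma> b, b := \<sigma> a)) {1..n} V \<longleftrightarrow> bij_betw \<sigma> {1..n} V"
    using bij_betw_swap_iff[of a "{1..n}" b \<sigma> V] assms(2,3) by simp
  then show ?thesis
    using assms by (auto simp: bijections_def extensional_def)
qed

text \<open>
  The walk is a geodesic of the affine symmetric group: as long as the displacement \<open>y - x\<close> is not
  constant, it drops somewhere along the cycle, and the two neighbours at the drop have a
  winding difference in \<open>x\<close> smaller than in \<open>y\<close>. They are therefore friends, and swapping them helps.
\<close>
lemma walk_between_lifts:
  assumes "\<sigma> \<in> B" "\<tau> \<in> B" "is_lift \<sigma> x" "is_lift \<tau> y" "compatible_lifts x y"
  shows "\<exists>k\<le>deficit x y. (\<sigma>, \<tau>) \<in> R ^^ k"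
  using assms
proof (induction "deficit x y" arbitrary: \<sigma> x rule: less_induct)
  case less
  show ?case
  proof (cases "\<forall>i\<in>{1..n}. y (\<sigma> i) - x (\<sigma> i) \<le> y (\<sigma> (succ_mod n i)) - x (\<sigma> (succ_mod n i))")
    case True
    have "x v = y v" if "v \<in> V" for v
      using less.prems(1,5) True that
      by (intro lift_eq_if_nondecreasing[of \<sigma> x y v]) (auto simp: compatible_lifts_def)
    then have "\<sigma> = \<tau>"
      using less.prems by (intro lift_unique[of \<sigma> \<tau> x y]) auto
    then show ?thesis
      by (intro exI[of _ 0]) simp
  next
    case False
    then obtain a where a: "a \<in> {1..n}"
      and drop: "y (\<sigma> (succ_mod n a)) - x (\<sigma> (succ_mod n a)) < y (\<sigma> a) - x (\<sigma> a)"
      by (auto simp: not_le)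
    define b u w where "b = succ_mod n a" and "u = \<sigma> a" and "w = \<sigma> b"
    have b: "b \<in> {1..n}" "a \<noteq> b"
      using a drop succ_mod_in by (auto simp: b_def)
    then have n: "n \<ge> 2"
      using a by auto
    define \<sigma>' where "\<sigma>' = \<sigma>(a := \<sigma> b, b := \<sigma> a)"
    have \<sigma>': "\<sigma>' a = \<sigma> b" "\<sigma>' b = \<sigma> a" "\<And>c. c \<in> {1..n} - {a, b} \<Longrightarrow> \<sigma>' c = \<sigma> c"
      using b by (auto simp: \<sigma>'_def)
    have \<sigma>'B: "\<sigma>' \<in> B"
      unfolding \<sigma>'_def using less.prems(1) a b(1) by (rule bij_swap)
    note lift = is_lift_swap[OF less.prems(1,3) a b_def b(2) \<sigma>', folded u_def w_def]
    have uw: "u \<in> V" "w \<in> V"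
      using bij_image(1)[OF less.prems(1)] a b(1) by (auto simp: u_def w_def)
    note deficit = deficit_swap_less[OF n less.prems(1,3,2,4) uw lift(3,2)
        drop[folded b_def, folded u_def w_def]]
    have friends: "(u, w) \<in> parcs Y"
      using deficit(2) less.prems(5) uw lift(3) by (auto simp: compatible_lifts_def strangers_def)
    have "compatible_lifts (swap u w x) y"
      using compatible_swap[OF less.prems(1,3) friends uw lift(3,2)] less.prems(5)
      by (rule compatible_lifts_trans)
    from less.hyps[OF deficit(1) \<sigma>'B less.prems(2) lift(1) less.prems(4) this]
    obtain k where k: "k \<le> deficit (swap u w x) y" "(\<sigma>', \<tau>) \<in> R ^^ k"
      by blast
    have "(\<sigma>, \<sigma>') \<in> R"
      using less.prems(1) \<sigma>'B a b(2) b_def friends \<sigma>' unfolding R_iff u_def w_def by blast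
    then have "(\<sigma>, \<tau>) \<in> R ^^ Suc k"
      using k(2) by (rule relpow_Suc_I2)
    then show ?thesis
      using k(1) deficit(1) by (intro exI[of _ "Suc k"]) auto
  qed
qed

section \<open>Bounding the length of a walk\<close>

text \<open>By \<open>div_diff_bound\<close>, \<open>n\<close> times the term of a pair is at most
  the two displacements plus \<open>n - 1\<close>. In the sum over ordered pairs each displacement
  occurs \<open>2 * n\<close> times, and a factor \<open>n\<close> cancels.\<close>

lemma deficit_le:
  assumes "n > 0"
  shows "int (deficit x y) \<le> 2 * (\<Sum>v\<in>V. \<bar>y v - x v\<bar>) + int n * (int n - 1)"
proof -
  define D where "D = (\<Sum>v\<in>V. \<bar>y v - x v\<bar>)"
  have "int n * int (nat ((y u - y v) div int n - (x u - x v) div int n))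
      \<le> \<bar>y u - x u\<bar> + \<bar>y v - x v\<bar> + (int n - 1)" for u v
  proof -
    have "int n * ((y u - y v) div int n - (x u - x v) div int n)
        \<le> \<bar>(y u - y v) - (x u - x v)\<bar> + (int n - 1)"
      using assms by (intro div_diff_bound) simp
    then show ?thesis
      using assms by (cases "(y u - y v) div int n - (x u - x v) div int n \<ge> 0") auto
  qed
  then have "(\<Sum>u\<in>V. \<Sum>v\<in>V. int n * int (nat ((y u - y v) div int n - (x u - x v) div int n)))
      \<le> (\<Sum>u\<in>V. \<Sum>v\<in>V. \<bar>y u - x u\<bar> + \<bar>y v - x v\<bar> + (int n - 1))"
    by (intro sum_mono)
  also have "\<dots> = int n * (2 * D + int n * (int n - 1))"
    by (simp add: sum.distrib card_verts ring_distribs flip: D_def sum_distrib_left)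
  finally have "int n * int (deficit x y) \<le> int n * (2 * D + int n * (int n - 1))"
    by (simp add: deficit_def sum_distrib_left flip: sum.cartesian_product)
  then show ?thesis
    using assms by (simp add: D_def)
qed

text \<open>Equal winding numbers put both differences into the same interval of \<open>n\<close>
  consecutive integers. This supplies the hypothesis of \<open>small_displacement\<close> for
  strangers.\<close>

lemma compatible_lifts_displacement:
  assumes "compatible_lifts x y" "(u, v) \<in> strangers" "n > 0"
  shows "\<bar>(y u - x u) - (y v - x v)\<bar> \<le> int n - 1"
proof -
  have "\<bar>(y u - y v) - (x u - x v)\<bar> \<le> int n - 1"
    using assms by (intro div_eq_imp_diff_less) (auto simp: compatible_lifts_def)
  then show ?thesis
    by (simp add: algebra_simps)
qed

lemma short_walk:
  assumes "\<sigma> \<in> B" "(\<sigma>, \<tau>) \<in> R\<^sup>*"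
  shows "\<exists>k\<le>8 * n ^ 4. (\<sigma>, \<tau>) \<in> R ^^ k"
proof (cases "n = 0")
  case True
  then have "(\<phi>, \<psi>) \<notin> R" for \<phi> \<psi>
    unfolding R_iff by simp
  then have "R = {}"
    by (metis equals0I surj_pair)
  then show ?thesis
    using assms(2) by (intro exI[of _ 0]) simp
next
  case False
  then have n: "n > 0"
    by simp
  have \<tau>: "\<tau> \<in> B"
    using assms(2,1) by (induction rule: rtrancl_induct) (auto simp: R_iff)
  obtain x where x: "is_lift \<sigma> x"
    using ex_lift[OF assms(1)] by blast
  obtain y where y: "is_lift \<tau> y" "compatible_lifts x y"
    using lift_walk[OF assms(2) x] by blast
  have "sym strangers" "strangers \<subseteq> V \<times> V"
    by (auto simp: strangers_def intro!: symI dest: sym_Y)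
  moreover have "(\<Sum>v\<in>V. y v - x v) = 0"
    using y(2) by (simp add: compatible_lifts_def sum_subtractf)
  ultimately obtain c where c: "sum c V = 0" "\<And>u v. (u, v) \<in> strangers \<Longrightarrow> c u = c v"
    "(\<Sum>v\<in>V. \<bar>(y v - x v) + int n * c v\<bar>) \<le> 2 * int n ^ 4 + 2 * int n ^ 3"
    using small_displacement[of V n strangers "\<lambda>v. y v - x v"] finite_V card_verts n
      compatible_lifts_displacement[OF y(2) _ n] by blast
  \<comment> \<open>Shifts by multiples of \<open>n\<close> keep a lift of \<open>\<tau>\<close>;
    \<open>c\<close> sums to zero and agrees on strangers, so both invariants survive.\<close>
  define z where "z v = y v + int n * c v" for v
  have z: "is_lift \<tau> z"
    unfolding is_lift_def
  proof
    fix i assume "i \<in> {1..n}"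
    then have "int n dvd (y (\<tau> i) - int i) + int n * c (\<tau> i)"
      using is_liftD[OF y(1)] by (intro dvd_add) simp_all
    then show "int n dvd z (\<tau> i) - int i"
      by (simp add: z_def algebra_simps)
  qed
  have "(z u - z v) div int n = (y u - y v) div int n" if "(u, v) \<in> strangers" for u v
    using c(2)[OF that] by (simp add: z_def)
  then have "compatible_lifts y z"
    using c(1) by (auto simp: compatible_lifts_def z_def sum.distrib simp flip: sum_distrib_left)
  then have "compatible_lifts x z"
    by (rule compatible_lifts_trans[OF y(2)])
  from walk_between_lifts[OF assms(1) \<tau> x z this]
  obtain k where k: "k \<le> deficit x z" "(\<sigma>, \<tau>) \<in> R ^^ k"
    by blast
  have "int (deficit x z) \<le> 2 * (2 * int n ^ 4 + 2 * int n ^ 3) + int n * (int n - 1)"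
    using deficit_le[OF n, of x z] c(3) by (simp add: z_def algebra_simps)
  also have "\<dots> \<le> 8 * int n ^ 4"
  proof -
    \<comment> \<open>The slack in the estimate, as a product of factors that are nonnegative for
      \<open>n \<ge> 1\<close>.\<close>
    have "4 * int n ^ 4 - 4 * int n ^ 3 - int n * (int n - 1)
        = int n * (int n - 1) * (4 * (int n * int n) - 1)"
      by (simp add: power_numeral_reduce algebra_simps)
    moreover have "\<dots> \<ge> 0"
      using n mult_mono[of 1 "int n" 1 "int n"] by (intro mult_nonneg_nonneg) auto
    ultimately show ?thesis
      by (simp add: algebra_simps)
  qed
  finally have "int (deficit x z) \<le> int (8 * n ^ 4)"
    by simp
  then have "deficit x z \<le> 8 * n ^ 4"
    by (simp only: of_nat_le_iff)
  then show ?thesis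
    using k by (intro exI[of _ k]) auto
qed

end

section \<open>Distances in a connected component\<close>

text \<open>Connectedness refers to the symmetric closure, but the arcs of \<open>G\<close> are
  already symmetric, so it amounts to reachability. The subgraph induced on everything reachable
  from \<open>u\<close> is connected and contains \<open>C\<close>; maximality gives
  equality.\<close>

lemma connected_component_eq:
  assumes "pair_graph G" and C: "connected_component (with_proj G) C" and u: "u \<in> verts C"
  shows "C = with_proj G \<restriction> {w. u \<rightarrow>\<^sup>*\<^bsub>with_proj G\<^esub> w}" (is "C = ?K")
proof -
  interpret pair_graph G by (rule assms(1))
  have sub: "subgraph C (with_proj G)" and conn: "connected C"
    and max: "\<And>H. H \<noteq> C \<Longrightarrow> subgraph C H \<Longrightarrow> subgraph H (with_proj G) \<Longrightarrow> \<not> connected H"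
    using C by (auto simp: connected_component_def max_subgraph_def)
  have verts_le: "verts C \<subseteq> pverts G"
    using sub by (simp add: subgraph_def)
  have reach: "u \<rightarrow>\<^sup>*\<^bsub>with_proj G\<^esub> v" if "v \<in> verts C" for v
  proof -
    have "u \<rightarrow>\<^sup>*\<^bsub>with_proj (mk_symmetric C)\<^esub> v"
      using conn u that by (auto simp: connected_def)
    then have "u \<rightarrow>\<^sup>*\<^bsub>with_proj (mk_symmetric (with_proj G))\<^esub> v"
      using subgraph_mk_symmetric[OF sub] by (rule pre_digraph.reachable_mono)
    then show ?thesis
      using reachable_mk_symmetric_eq[OF sym_arcs] by simp
  qed
  have "?K \<in> sccs"
    using u verts_le by (intro induce_reachable_is_in_sccs) auto
  then have sc: "strongly_connected ?K" and ind: "induced_subgraph ?K (with_proj G)"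
    by auto
  then have K: "subgraph ?K (with_proj G)"
    by (simp add: induced_imp_subgraph)
  then interpret K: wf_digraph ?K
    by auto
  have "connected ?K"
    using sc by (intro K.connectedI) (auto simp: strongly_connected_def intro: K.reachable_mk_symmetricI)
  moreover have "subgraph C ?K"
    using subgraph_induce_subgraphI2[OF sub] reach
    by (auto simp: subgraph_def compatible_def)
  ultimately show ?thesis
    using max[of ?K] K by blast
qed

text \<open>The walk in \<open>G\<close> never leaves \<open>C\<close>, hence is a walk of
  \<open>C\<close>, and with unit weights its cost is its length.\<close>

lemma mu_le_relpow:
  assumes "pair_graph G" "connected_component (with_proj G) C" "u \<in> verts C"
    and "(u, v) \<in> parcs G ^^ k"
  shows "wf_digraph.\<mu> C (\<lambda>_. 1) u v \<le> ereal (real k)"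
proof -
  interpret pair_graph G by (rule assms(1))
  interpret C: wf_digraph C
    using assms(2) by (auto simp: connected_component_def max_subgraph_def)
  have "\<exists>p. C.awalk u p v \<and> length p = k"
    using assms(3,4)
  proof (induction k arbitrary: u)
    case 0
    then show ?case
      by (intro exI[of _ "[]"]) (simp add: C.awalk_Nil_iff)
  next
    case (Suc k)
    obtain w where w: "(u, w) \<in> parcs G" "(w, v) \<in> parcs G ^^ k"
      using Suc.prems(2) by (rule relpow_Suc_E2)
    \<comment> \<open>The description of \<open>C\<close> is taken from the current vertex, so it
      shows that the next arc lies in \<open>C\<close>.\<close>
    have eq: "C = with_proj G \<restriction> {w. u \<rightarrow>\<^sup>*\<^bsub>with_proj G\<^esub> w}"
      using assms(1,2) Suc.prems(1) by (rule connected_component_eq)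
    have "u \<rightarrow>\<^sup>*\<^bsub>with_proj G\<^esub> w" "u \<rightarrow>\<^sup>*\<^bsub>with_proj G\<^esub> u"
      using w(1) in_arcsD1[OF w(1)] by auto
    then have "(u, w) \<in> arcs C" "tail C (u, w) = u" "head C (u, w) = w" "w \<in> verts C"
      using w(1) by (auto simp: arg_cong[OF eq, of arcs] arg_cong[OF eq, of verts]
          arg_cong[OF eq, of tail] arg_cong[OF eq, of head])
    moreover obtain p where "C.awalk w p v" "length p = k"
      using Suc.IH[OF \<open>w \<in> verts C\<close> w(2)] by blast
    ultimately show ?case
      by (intro exI[of _ "(u, w) # p"]) (simp add: C.awalk_Cons_iff)
  qed
  then obtain p where p: "C.awalk u p v" "length p = k"
    by blast
  have "C.awalk_cost (\<lambda>_. 1) p = real k"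
    using p(2) by (simp add: C.awalk_cost_def sum_list_triv)
  then show ?thesis
    using C.min_cost_le_walk_cost[OF p(1), of "\<lambda>_. 1"] by simp
qed

lemma component_reachable:
  assumes "pair_graph G" "connected_component (with_proj G) C" "u \<in> verts C" "v \<in> verts C"
  shows "u \<in> pverts G" "(u, v) \<in> (parcs G)\<^sup>*"
proof -
  interpret pair_graph G by (rule assms(1))
  have reach: "u \<rightarrow>\<^sup>*\<^bsub>with_proj G\<^esub> v"
    using connected_component_eq[OF assms(1-3)] assms(4)
    by (metis (mono_tags, lifting) induce_subgraph_verts mem_Collect_eq)
  then show "u \<in> pverts G"
    by (elim reachable_in_vertsE) simp
  show "(u, v) \<in> (parcs G)\<^sup>*"
    using reachable_rtranclI[OF reach] by simp
qed

theorem theorem3p9: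
  shows "\<exists>\<epsilon> :: nat \<Rightarrow> real. \<epsilon> \<longlonglongrightarrow> 0 \<and>
    (\<forall>n :: nat. \<forall>Y :: 'v pair_pre_digraph. pair_graph Y \<and> card (pverts Y) = n \<longrightarrow>
      (\<forall>C. connected_component (with_proj (FS (cycle_graph n) Y)) C \<longrightarrow>
        graph_diameter C \<le> ereal (8 * real n ^ 4 * (1 + \<epsilon> n))))"
proof (intro exI[of _ "\<lambda>_. 0"] conjI allI impI)
  show "(\<lambda>_. 0 :: real) \<longlonglongrightarrow> 0"
    by simp
  fix n and Y :: "'v pair_pre_digraph" and C
  assume Y: "pair_graph Y \<and> card (pverts Y) = n"
    and C: "connected_component (with_proj (FS (cycle_graph n) Y)) C"
  interpret fs_cycle Y n
    using Y by (simp add: fs_cycle_def)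
  have FS: "pair_graph (FS (cycle_graph n) Y)"
    using Y by (simp add: pair_graph_FS pair_graph_cycle_graph)
  have "wf_digraph.\<mu> C (\<lambda>_. 1) u v \<le> ereal (8 * real n ^ 4 * (1 + 0))"
    if uv: "u \<in> verts C" "v \<in> verts C" for u v
  proof -
    have "u \<in> B"
      using component_reachable(1)[OF FS C uv] by (simp add: FS_def cycle_graph_def)
    then obtain k where k: "k \<le> 8 * n ^ 4" "(u, v) \<in> R ^^ k"
      using short_walk component_reachable(2)[OF FS C uv] by blast
    have "wf_digraph.\<mu> C (\<lambda>_. 1) u v \<le> ereal (real k)"
      using FS C uv(1) k(2) by (rule mu_le_relpow)
    also have "real k \<le> real (8 * n ^ 4)"
      using k(1) by (rule of_nat_mono)
    finally show ?thesis
      by simp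
  qed
  then show "graph_diameter C \<le> ereal (8 * real n ^ 4 * (1 + 0))"
    unfolding graph_diameter_def by (intro SUP_least)
qed

end
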